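(* Consider the model in which the response mechanism is $\operatorname{logit}\{P(\delta=1\mid \boldsymbol{x},y;\boldsymbol{\alpha},\beta)\}=h(\boldsymbol{x};\boldsymbol{\alpha})+\beta y$, and the conditional distribution $[y\mid\boldsymbol{x},\delta=1]$ has the exponential family density $$f(y\mid\boldsymbol{x},\delta=1;\boldsymbol{\gamma})=\exp\left[\tau\{y\theta-b(\theta)\}+c(y;\tau)\right],\qquad \theta=\theta\Big(\sum_{l=1}^{L}\eta_l(\boldsymbol{x})\kappa_l\Big),\quad \boldsymbol{\gamma}=(\tau,\kappa_1,\ldots,\kappa_L)^{\top},$$ and suppose that the family of distributions $[y\mid\boldsymbol{x},\delta=1]$ is identifiable (that is, equality of $f(y\mid\boldsymbol{x},\delta=1;\boldsymbol{\gamma})$ and $f(y\mid\boldsymbol{x},\delta=1;\boldsymbol{\gamma}')$ with probability one implies $\boldsymbol{\gamma}=\boldsymbol{\gamma}'$). Define $$\varphi(\boldsymbol{\alpha},\beta,\boldsymbol{\gamma})=h(\boldsymbol{x};\boldsymbol{\alpha})-\tau\, b\left\{\theta\Big(\sum_{l=1}^{L}\eta_l(\boldsymbol{x})\kappa_l\Big)-\frac{\beta}{\tau}\right\},$$ regarded as a function of $\boldsymbol{x}$. Then the model is identifiable if and only if, for all parameter values $\boldsymbol{\alpha},\boldsymbol{\alpha}',\beta,\beta',\boldsymbol{\gamma}$, $$\varphi(\boldsymbol{\alpha},\beta,\boldsymbol{\gamma})=\varphi(\boldsymbol{\alpha}',\beta',\boldsymbol{\gamma})\ \Rightarrow\ \beta=\beta',$$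 where the equality on the left is equality as functions of $\boldsymbol{x}$, with probability one under the distribution of $\boldsymbol{x}$.
   Context: $(\boldsymbol{x},y,\delta)$ are random variables: $\boldsymbol{x}$ is a fully observed covariate vector, $y$ is a real outcome subject to missingness, and $\delta\in\{0,1\}$ is the response indicator ($\delta=1$ iff $y$ is observed). $\operatorname{logit}(z)=\log\{z/(1-z)\}$ for $0<z<1$. The function $h(\boldsymbol{x};\boldsymbol{\alpha})$ is known up to the finite-dimensional parameter $\boldsymbol{\alpha}$ and is injective in $\boldsymbol{\alpha}$: if $h(\boldsymbol{x};\boldsymbol{\alpha})=h(\boldsymbol{x};\boldsymbol{\alpha}')$ with probability one in $\boldsymbol{x}$, then $\boldsymbol{\alpha}=\boldsymbol{\alpha}'$. The parameters $\boldsymbol{\alpha}$, $\beta\in\mathbb{R}$, $\boldsymbol{\gamma}$ range over a product parameter space. The functions $b$, $c$, $\theta(\cdot)$ and $\eta_1,\ldots,\eta_L$ are known; $\tau>0$. Densities of $y$ are with respect to a fixed dominating measure $dy$ (e.g. Lebesgue or counting measure), and $b$ is the normalizing function: $\int\exp\{\tau y t+c(y;\tau)\}\,dy=\exp\{\tau b(t)\}$ for all relevant $t$, including $t=\theta-\beta/\tau$ (so $\int e^{-\beta y}f(y\mid\boldsymbol{x},\delta=1;\boldsymbol{\gamma})\,dy<\infty$). The density $f(y\mid\boldsymbol{x};\boldsymbol{\alpha},\beta,\boldsymbol{\gamma})$ of $[y\mid\boldsymbol{x}]$ is the one determined by the response mechanism and the respondents' density through Bayes' theorem: $$P(\delta=1\mid\boldsymbol{x},y;\boldsymbol{\alpha},\beta)f(y\mid\boldsymbol{x};\boldsymbol{\alpha},\beta,\boldsymbol{\gamma})=\frac{f(y\mid\boldsymbol{x},\delta=1;\boldsymbol{\gamma})}{\int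 f(u\mid\boldsymbol{x},\delta=1;\boldsymbol{\gamma})\{P(\delta=1\mid\boldsymbol{x},u;\boldsymbol{\alpha},\beta)\}^{-1}\,du}.$$ The model is called identifiable if $$P(\delta=1\mid\boldsymbol{x},y;\boldsymbol{\alpha},\beta)f(y\mid\boldsymbol{x};\boldsymbol{\alpha},\beta,\boldsymbol{\gamma})=P(\delta=1\mid\boldsymbol{x},y;\boldsymbol{\alpha}',\beta')f(y\mid\boldsymbol{x};\boldsymbol{\alpha}',\beta',\boldsymbol{\gamma}')$$ with probability one (for almost every $\boldsymbol{x}$ under its distribution and almost every $y$) implies $(\boldsymbol{\alpha},\beta,\boldsymbol{\gamma})=(\boldsymbol{\alpha}',\beta',\boldsymbol{\gamma}')$. *)

theory Defs
  imports "HOL-Probability.Probability"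
begin

definition logit :: "real \<Rightarrow> real" where
  "logit z = ln (z / (1 - z))"

definition linear_predictor :: "('l::finite \<Rightarrow> 'x \<Rightarrow> real) \<Rightarrow> real ^ 'l \<Rightarrow> 'x \<Rightarrow> real" where
  "linear_predictor \<eta> \<kappa> x = (\<Sum>l\<in>UNIV. \<eta> l x * \<kappa> $ l)"

text \<open>The respondents' density of \<open>[y | x, \<delta> = 1]\<close>, with parameter \<open>\<gamma> = (\<tau>, \<kappa>)\<close>.\<close>

definition exp_family_density ::
  "(real \<Rightarrow> real) \<Rightarrow> (real \<Rightarrow> real \<Rightarrow> real) \<Rightarrow> (real \<Rightarrow> real) \<Rightarrow> ('l::finite \<Rightarrow> 'x \<Rightarrow> real) \<Rightarrow>
   real \<times> (real ^ 'l) \<Rightarrow> 'x \<Rightarrow> real \<Rightarrow> real" where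
  "exp_family_density b c \<theta> \<eta> \<gamma> x y =
     (let \<tau> = fst \<gamma>; t = \<theta> (linear_predictor \<eta> (snd \<gamma>) x)
      in exp (\<tau> * (y * t - b t) + c y \<tau>))"

text \<open>
  The outcome density \<open>f(y | x)\<close> at a fixed \<open>x\<close>, recovered from the response
  probability \<open>p y = P(\<delta> = 1 | x, y)\<close> and the respondents' density
  \<open>g y = f(y | x, \<delta> = 1)\<close>. The dominating measure \<open>\<nu>\<close> plays the role of \<open>dy\<close>.
\<close>

definition outcome_density ::
  "real measure \<Rightarrow> (real \<Rightarrow> real) \<Rightarrow> (real \<Rightarrow> real) \<Rightarrow> real \<Rightarrow> real" where
  "outcome_density \<nu> p g y = (g y / p y) / (\<integral>u. g u * inverse (p u) \<partial>\<nu>)"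

lemma outcome_density_bayes:
  assumes "p y \<noteq> 0"
  shows "p y * outcome_density \<nu> p g y = g y / (\<integral>u. g u * inverse (p u) \<partial>\<nu>)"
  using assms by (simp add: outcome_density_def)

text \<open>
  In the next two definitions \<open>M\<close> is the distribution of \<open>x\<close>, and \<open>A\<close>, \<open>B\<close>, \<open>G\<close> are the
  parameter spaces of \<open>\<alpha>\<close>, \<open>\<beta>\<close>, \<open>\<gamma>\<close>.
\<close>

definition respondents_identifiable ::
  "'x measure \<Rightarrow> real measure \<Rightarrow> 'g set \<Rightarrow> ('g \<Rightarrow> 'x \<Rightarrow> real \<Rightarrow> real) \<Rightarrow> bool" where
  "respondents_identifiable M \<nu> G g \<longleftrightarrow>
     (\<forall>\<gamma>\<in>G. \<forall>\<gamma>'\<in>G. (AE x in M. AE y in \<nu>. g \<gamma> x y = g \<gamma>' x y) \<longrightarrow> \<gamma> = \<gamma>')"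

definition model_identifiable ::
  "'x measure \<Rightarrow> real measure \<Rightarrow> 'a set \<Rightarrow> real set \<Rightarrow> 'g set \<Rightarrow>
   ('a \<Rightarrow> real \<Rightarrow> 'x \<Rightarrow> real \<Rightarrow> real) \<Rightarrow> ('g \<Rightarrow> 'x \<Rightarrow> real \<Rightarrow> real) \<Rightarrow> bool" where
  "model_identifiable M \<nu> A B G p g \<longleftrightarrow>
     (\<forall>\<alpha>\<in>A. \<forall>\<alpha>'\<in>A. \<forall>\<beta>\<in>B. \<forall>\<beta>'\<in>B. \<forall>\<gamma>\<in>G. \<forall>\<gamma>'\<in>G.
        (AE x in M. AE y in \<nu>.
           p \<alpha> \<beta> x y * outcome_density \<nu> (p \<alpha> \<beta> x) (g \<gamma> x) y =
           p \<alpha>' \<beta>' x y * outcome_density \<nu> (p \<alpha>' \<beta>' x) (g \<gamma>' x) y)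
        \<longrightarrow> (\<alpha>, \<beta>, \<gamma>) = (\<alpha>', \<beta>', \<gamma>'))"

definition \<phi> ::
  "('x \<Rightarrow> 'a \<Rightarrow> real) \<Rightarrow> (real \<Rightarrow> real) \<Rightarrow> (real \<Rightarrow> real) \<Rightarrow> ('l::finite \<Rightarrow> 'x \<Rightarrow> real) \<Rightarrow>
   'a \<Rightarrow> real \<Rightarrow> real \<times> (real ^ 'l) \<Rightarrow> 'x \<Rightarrow> real" where
  "\<phi> h b \<theta> \<eta> \<alpha> \<beta> \<gamma> x =
     (let \<tau> = fst \<gamma>
      in h x \<alpha> - \<tau> * b (\<theta> (linear_predictor \<eta> (snd \<gamma>) x) - \<beta> / \<tau>))"

end

theory Submission
  imports Defs
begin

text \<open>
  Integrating the respondents' density against the inverse response probability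
  \<open>1 + exp (- h - \<beta> y)\<close> tilts the exponential family by \<open>- \<beta> / \<tau>\<close>, so the normalizing
  constant in Bayes' theorem is \<open>1 + exp (- \<phi> - \<tau> b(\<theta>))\<close>. If two models agree, then the
  two respondents' densities are proportional in \<open>y\<close>, hence equal, as both integrate to one. This
  identifies \<open>\<gamma>\<close> and leaves exactly the equation \<open>\<phi> = \<phi>'\<close>. Once \<open>\<beta>\<close> is known,
  this equation reduces to \<open>h = h'\<close>, which identifies \<open>\<alpha>\<close>.
\<close>

lemma inverse_eq_one_plus_exp_if_logit:
  assumes "0 < p" "p < 1" "logit p = z"
  shows "inverse p = 1 + exp (- z)"
proof -
  have "exp z = p / (1 - p)"
    using assms by (auto simp: logit_def)
  then show ?thesis
    using assms(1,2) by (simp add: exp_minus field_simps)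
qed

text \<open>The factor free of \<open>y\<close> is split off, so that the remaining factor is
  literally the integrand of the normalizing condition.\<close>

lemma exp_family_density_eq:
  "exp_family_density b c \<theta> \<eta> (\<tau>, \<kappa>) x y =
     exp (\<tau> * y * \<theta> (linear_predictor \<eta> \<kappa> x) + c y \<tau>) *
     exp (- \<tau> * b (\<theta> (linear_predictor \<eta> \<kappa> x)))"
  by (simp add: exp_family_density_def Let_def flip: exp_add) (simp add: algebra_simps)

text \<open>Since \<tau> y t - \<beta> y = \<tau> y (t - \<beta>/\<tau>), the weight is absorbed
  into the natural parameter. Only the factor depending on \<open>y\<close> is shifted; the
  normalizer keeps the old parameter, so the integral becomes a ratio of two normalizers.\<close>

lemma exp_family_density_tilt:
  assumes "\<tau> \<noteq> 0"
  shows "exp_family_density b c \<theta> \<eta> (\<tau>, \<kappa>) x y * exp (- (\<beta> * y)) =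
     exp (\<tau> * y * (\<theta> (linear_predictor \<eta> \<kappa> x) - \<beta> / \<tau>) + c y \<tau>) *
     exp (- \<tau> * b (\<theta> (linear_predictor \<eta> \<kappa> x)))"
  using assms
  by (simp add: exp_family_density_def Let_def flip: exp_add) (simp add: field_simps)

lemma has_bochner_integral_exp_family_density:
  assumes "has_bochner_integral \<nu>
    (\<lambda>y. exp (\<tau> * y * \<theta> (linear_predictor \<eta> \<kappa> x) + c y \<tau>))
    (exp (\<tau> * b (\<theta> (linear_predictor \<eta> \<kappa> x))))"
  shows "has_bochner_integral \<nu> (exp_family_density b c \<theta> \<eta> (\<tau>, \<kappa>) x) 1"
proof -
  have "has_bochner_integral \<nu> (\<lambda>y. exp_family_density b c \<theta> \<eta> (\<tau>, \<kappa>) x y)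
      (exp (\<tau> * b (\<theta> (linear_predictor \<eta> \<kappa> x))) *
       exp (- \<tau> * b (\<theta> (linear_predictor \<eta> \<kappa> x))))"
    unfolding exp_family_density_eq
    by (rule has_bochner_integral_mult_left) (use assms in simp)
  then show ?thesis
    by (simp flip: exp_add)
qed

lemma bayes_constant_exp_family:
  assumes "\<tau> \<noteq> 0"
    and "has_bochner_integral \<nu>
      (\<lambda>y. exp (\<tau> * y * \<theta> (linear_predictor \<eta> \<kappa> x) + c y \<tau>))
      (exp (\<tau> * b (\<theta> (linear_predictor \<eta> \<kappa> x))))"
    and shift: "has_bochner_integral \<nu>
      (\<lambda>y. exp (\<tau> * y * (\<theta> (linear_predictor \<eta> \<kappa> x) - \<beta> / \<tau>) + c y \<tau>))
      (exp (\<tau> * b (\<theta> (linear_predictor \<eta> \<kappa> x) - \<beta> / \<tau>)))"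
    and p: "\<And>y. inverse (p y) = 1 + exp (- (h x \<alpha> + \<beta> * y))"
  shows "(\<integral>y. exp_family_density b c \<theta> \<eta> (\<tau>, \<kappa>) x y * inverse (p y) \<partial>\<nu>) =
    1 + exp (- \<phi> h b \<theta> \<eta> \<alpha> \<beta> (\<tau>, \<kappa>) x - \<tau> * b (\<theta> (linear_predictor \<eta> \<kappa> x)))"
proof -
  let ?g = "exp_family_density b c \<theta> \<eta> (\<tau>, \<kappa>) x"
  let ?t = "\<theta> (linear_predictor \<eta> \<kappa> x)"
  have "has_bochner_integral \<nu> (\<lambda>y. ?g y * exp (- (\<beta> * y)))
      (exp (\<tau> * b (?t - \<beta> / \<tau>)) * exp (- \<tau> * b ?t))"
    unfolding exp_family_density_tilt[OF assms(1)]
    by (rule has_bochner_integral_mult_left) (use shift in simp)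
  \<comment> \<open>The two summands come from the 1 and the exponential in
    \<open>inverse (p y)\<close>: the first is the density itself, the second its tilt scaled by a
    factor constant in \<open>y\<close>.\<close>
  then have "has_bochner_integral \<nu> (\<lambda>y. ?g y + ?g y * exp (- (\<beta> * y)) * exp (- h x \<alpha>))
      (1 + exp (\<tau> * b (?t - \<beta> / \<tau>)) * exp (- \<tau> * b ?t) * exp (- h x \<alpha>))"
    using has_bochner_integral_exp_family_density[where b = b and c = c and \<theta> = \<theta>, OF assms(2)]
    by (intro has_bochner_integral_add has_bochner_integral_mult_left) auto
  moreover have "?g y + ?g y * exp (- (\<beta> * y)) * exp (- h x \<alpha>) = ?g y * inverse (p y)" for y
    unfolding p by (simp add: distrib_left exp_diff exp_minus exp_add field_simps)
  ultimately have "(\<integral>y. ?g y * inverse (p y) \<partial>\<nu>) =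
      1 + exp (\<tau> * b (?t - \<beta> / \<tau>)) * exp (- \<tau> * b ?t) * exp (- h x \<alpha>)"
    by (simp add: has_bochner_integral_integral_eq)
  \<comment> \<open>Collecting exponents, \<tau> b(t - \<beta>/\<tau>) - h is exactly
    -\<phi>.\<close>
  then show ?thesis
    by (simp add: \<phi>_def Let_def algebra_simps flip: exp_add)
qed

text \<open>Integrating the hypothesis over \<open>y\<close> gives \<open>1 / k = 1 / l\<close>. As
  division by zero yields 0, this forces \<open>k = l\<close> in every case; the common nonzero
  factor then cancels pointwise.\<close>

lemma proportional_densities_eq:
  fixes f g :: "'y \<Rightarrow> real"
  assumes f: "has_bochner_integral \<nu> f 1" and g: "has_bochner_integral \<nu> g 1"
    and "k \<noteq> 0"
    and ae: "AE y in \<nu>. f y / k = g y / l"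
  shows "k = l" and "AE y in \<nu>. f y = g y"
proof -
  note [measurable] = borel_measurable_has_bochner_integral[OF f]
    borel_measurable_has_bochner_integral[OF g]
  have "(\<integral>y. f y / k \<partial>\<nu>) = (\<integral>y. g y / l \<partial>\<nu>)"
    by (rule integral_cong_AE) (use ae in auto)
  then show "k = l"
    using f g by (simp add: has_bochner_integral_integral_eq)
  with ae \<open>k \<noteq> 0\<close> show "AE y in \<nu>. f y = g y"
    by simp
qed

theorem theorem1:
  fixes M :: "(real ^ 'd) measure"
    and \<nu> :: "real measure"
    and A :: "(real ^ 'p) set" and B :: "real set" and G :: "(real \<times> (real ^ 'l)) set"
    and h :: "real ^ 'd \<Rightarrow> real ^ 'p \<Rightarrow> real"
    and resp :: "real ^ 'p \<Rightarrow> real \<Rightarrow> real ^ 'd \<Rightarrow> real \<Rightarrow> real"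
    and b :: "real \<Rightarrow> real" and c :: "real \<Rightarrow> real \<Rightarrow> real" and \<theta> :: "real \<Rightarrow> real"
    and \<eta> :: "'l \<Rightarrow> real ^ 'd \<Rightarrow> real"
  assumes "prob_space M" and "sets M = sets borel"
    and tau_pos: "\<And>\<tau> \<kappa>. (\<tau>, \<kappa>) \<in> G \<Longrightarrow> \<tau> > 0"
    and h_injective: "\<And>\<alpha> \<alpha>'. \<alpha> \<in> A \<Longrightarrow> \<alpha>' \<in> A \<Longrightarrow> (AE x in M. h x \<alpha> = h x \<alpha>') \<Longrightarrow> \<alpha> = \<alpha>'"
    and resp_range: "\<And>\<alpha> \<beta> x y. \<alpha> \<in> A \<Longrightarrow> \<beta> \<in> B \<Longrightarrow> 0 < resp \<alpha> \<beta> x y \<and> resp \<alpha> \<beta> x y < 1"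
    and resp_logit: "\<And>\<alpha> \<beta> x y. \<alpha> \<in> A \<Longrightarrow> \<beta> \<in> B \<Longrightarrow> logit (resp \<alpha> \<beta> x y) = h x \<alpha> + \<beta> * y"
    and normalizing: "\<And>\<tau> \<kappa>. (\<tau>, \<kappa>) \<in> G \<Longrightarrow>
      AE x in M. let t = \<theta> (linear_predictor \<eta> \<kappa> x) in
        has_bochner_integral \<nu> (\<lambda>y. exp (\<tau> * y * t + c y \<tau>)) (exp (\<tau> * b t))"
    and normalizing_shift: "\<And>\<tau> \<kappa> \<beta>. (\<tau>, \<kappa>) \<in> G \<Longrightarrow> \<beta> \<in> B \<Longrightarrow>
      AE x in M. let t = \<theta> (linear_predictor \<eta> \<kappa> x) - \<beta> / \<tau> in
        has_bochner_integral \<nu> (\<lambda>y. exp (\<tau> * y * t + c y \<tau>)) (exp (\<tau> * b t))"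
    and "respondents_identifiable M \<nu> G (exp_family_density b c \<theta> \<eta>)"
  shows "model_identifiable M \<nu> A B G resp (exp_family_density b c \<theta> \<eta>) \<longleftrightarrow>
    (\<forall>\<alpha>\<in>A. \<forall>\<alpha>'\<in>A. \<forall>\<beta>\<in>B. \<forall>\<beta>'\<in>B. \<forall>\<gamma>\<in>G.
       (AE x in M. \<phi> h b \<theta> \<eta> \<alpha> \<beta> \<gamma> x = \<phi> h b \<theta> \<eta> \<alpha>' \<beta>' \<gamma> x) \<longrightarrow> \<beta> = \<beta>')"
proof -
  let ?g = "exp_family_density b c \<theta> \<eta>"
  let ?I = "\<lambda>\<alpha> \<beta> \<gamma> x. \<integral>u. ?g \<gamma> x u * inverse (resp \<alpha> \<beta> x u) \<partial>\<nu>"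
  let ?f = "\<lambda>\<alpha> \<beta> \<gamma> x y. resp \<alpha> \<beta> x y * outcome_density \<nu> (resp \<alpha> \<beta> x) (?g \<gamma> x) y"
  \<comment> \<open>The positive response probability cancels, so \<alpha> and \<beta> enter the
    compared quantity only through \<open>?I\<close>, which is constant in \<open>y\<close>.\<close>
  have bayes: "?f \<alpha> \<beta> \<gamma> x y = ?g \<gamma> x y / ?I \<alpha> \<beta> \<gamma> x"
    if "\<alpha> \<in> A" "\<beta> \<in> B" for \<alpha> \<beta> \<gamma> x y
    using resp_range[OF that, of x y] by (intro outcome_density_bayes) simp
  have density: "AE x in M. has_bochner_integral \<nu> (?g \<gamma> x) 1" if "\<gamma> \<in> G" for \<gamma>
  proof (cases \<gamma>)
    case (Pair \<tau> \<kappa>)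
    from normalizing[OF that[unfolded Pair]] show ?thesis
      unfolding Pair Let_def
      by (rule eventually_mono) (rule has_bochner_integral_exp_family_density)
  qed
  \<comment> \<open>Beside \<phi>, the exponent contains only a term in \<gamma> and
    \<open>x\<close>. For a common \<gamma>, equality of the constants therefore amounts to equality
    of the \<phi> values.\<close>
  have const: "AE x in M. ?I \<alpha> \<beta> \<gamma> x =
      1 + exp (- \<phi> h b \<theta> \<eta> \<alpha> \<beta> \<gamma> x - fst \<gamma> * b (\<theta> (linear_predictor \<eta> (snd \<gamma>) x)))"
    if "\<alpha> \<in> A" "\<beta> \<in> B" "\<gamma> \<in> G" for \<alpha> \<beta> \<gamma>
  proof (cases \<gamma>)
    case (Pair \<tau> \<kappa>)
    with that have G: "(\<tau>, \<kappa>) \<in> G" by simp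
    have p: "inverse (resp \<alpha> \<beta> x y) = 1 + exp (- (h x \<alpha> + \<beta> * y))" for x y
      using resp_range resp_logit that by (intro inverse_eq_one_plus_exp_if_logit) auto
    from normalizing[OF G] normalizing_shift[OF G \<open>\<beta> \<in> B\<close>] show ?thesis
      unfolding Pair Let_def fst_conv snd_conv
    proof eventually_elim
      case (elim x)
      with tau_pos[OF G] p show ?case
        by (intro bayes_constant_exp_family) auto
    qed
  qed
  show ?thesis
  proof
    assume ident: "model_identifiable M \<nu> A B G resp ?g"
    show "\<forall>\<alpha>\<in>A. \<forall>\<alpha>'\<in>A. \<forall>\<beta>\<in>B. \<forall>\<beta>'\<in>B. \<forall>\<gamma>\<in>G.
       (AE x in M. \<phi> h b \<theta> \<eta> \<alpha> \<beta> \<gamma> x = \<phi> h b \<theta> \<eta> \<alpha>' \<beta>' \<gamma> x) \<longrightarrow> \<beta> = \<beta>'"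
    proof (intro ballI impI)
      fix \<alpha> \<alpha>' \<beta> \<beta>' \<gamma>
      assume *: "\<alpha> \<in> A" "\<alpha>' \<in> A" "\<beta> \<in> B" "\<beta>' \<in> B" "\<gamma> \<in> G"
        and "AE x in M. \<phi> h b \<theta> \<eta> \<alpha> \<beta> \<gamma> x = \<phi> h b \<theta> \<eta> \<alpha>' \<beta>' \<gamma> x"
      \<comment> \<open>Both sides share \<gamma>, hence the numerator \<open>?g\<close>; equal
        \<phi> makes the denominators equal too, so the two models agree at every
        \<open>y\<close>.\<close>
      from this(6) const[OF *(1,3,5)] const[OF *(2,4,5)]
      have "AE x in M. AE y in \<nu>. ?f \<alpha> \<beta> \<gamma> x y = ?f \<alpha>' \<beta>' \<gamma> x y"
        by eventually_elim (simp add: bayes *)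
      with ident * show "\<beta> = \<beta>'"
        unfolding model_identifiable_def by blast
    qed
  next
    assume \<phi>: "\<forall>\<alpha>\<in>A. \<forall>\<alpha>'\<in>A. \<forall>\<beta>\<in>B. \<forall>\<beta>'\<in>B. \<forall>\<gamma>\<in>G.
       (AE x in M. \<phi> h b \<theta> \<eta> \<alpha> \<beta> \<gamma> x = \<phi> h b \<theta> \<eta> \<alpha>' \<beta>' \<gamma> x) \<longrightarrow> \<beta> = \<beta>'"
    show "model_identifiable M \<nu> A B G resp ?g"
      unfolding model_identifiable_def
    proof (intro ballI impI)
      fix \<alpha> \<alpha>' \<beta> \<beta>' \<gamma> \<gamma>'
      assume *: "\<alpha> \<in> A" "\<alpha>' \<in> A" "\<beta> \<in> B" "\<beta>' \<in> B" "\<gamma> \<in> G" "\<gamma>' \<in> G"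
        and eq: "AE x in M. AE y in \<nu>. ?f \<alpha> \<beta> \<gamma> x y = ?f \<alpha>' \<beta>' \<gamma>' x y"
      from eq density[OF *(5)] density[OF *(6)] const[OF *(1,3,5)]
      have both: "AE x in M. ?I \<alpha> \<beta> \<gamma> x = ?I \<alpha>' \<beta>' \<gamma>' x \<and>
          (AE y in \<nu>. ?g \<gamma> x y = ?g \<gamma>' x y)"
      proof eventually_elim
        case (elim x)
        from elim(1) have ae: "AE y in \<nu>. ?g \<gamma> x y / ?I \<alpha> \<beta> \<gamma> x = ?g \<gamma>' x y / ?I \<alpha>' \<beta>' \<gamma>' x"
          by (simp only: bayes * simp_thms)
        \<comment> \<open>Being 1 plus an exponential, the constant is nonzero, as cancelling it
          from the proportional densities requires.\<close>
        have "?I \<alpha> \<beta> \<gamma> x > 0"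
          unfolding elim(4) by (rule add_pos_pos) simp_all
        then show ?case
          using proportional_densities_eq[OF elim(2,3) _ ae] by auto
      qed
      then have "AE x in M. AE y in \<nu>. ?g \<gamma> x y = ?g \<gamma>' x y"
        by eventually_elim simp
      with assms(9) * have \<gamma>: "\<gamma> = \<gamma>'"
        unfolding respondents_identifiable_def by blast
      \<comment> \<open>With \<gamma> = \<gamma>' the terms \<tau> b(\<theta>) in the two constants
        coincide, and injectivity of \<open>exp\<close> leaves equality of \<phi>.\<close>
      from both const[OF *(1,3,5)] const[OF *(2,4,5)]
      have \<phi>_eq: "AE x in M. \<phi> h b \<theta> \<eta> \<alpha> \<beta> \<gamma> x = \<phi> h b \<theta> \<eta> \<alpha>' \<beta>' \<gamma> x"
        by eventually_elim (simp add: \<gamma>)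
      with \<phi> * have \<beta>: "\<beta> = \<beta>'"
        by blast
      \<comment> \<open>With \<beta> and \<gamma> common, the shifted normalizer terms are the same
        function of \<open>x\<close> and cancel.\<close>
      from \<phi>_eq have "AE x in M. h x \<alpha> = h x \<alpha>'"
        by eventually_elim (simp add: \<phi>_def Let_def \<beta>)
      with h_injective * have "\<alpha> = \<alpha>'"
        by blast
      with \<beta> \<gamma> show "(\<alpha>, \<beta>, \<gamma>) = (\<alpha>', \<beta>', \<gamma>')"
        by simp
    qed
  qed
qed

end
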